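(* Let $\mu$ and $\nu$ be positive finite measures on $\mathbb{R}^d$ with finite supports such that $\mu\preceq_{\rm cxp}\nu$. Then for all $x\in\mathbb{R}^d$ such that $\mu(\{x\})>\nu(\{x\})$ there exist $k\in\{2,\dots,d+1\}$ and $k$ elements $y_1,\dots,y_k\in\mathrm{Supp}(\nu)$, distinct from $x$, such that $$\{x\}\ \subset\ \mathscr{C}(\{y_1,\dots,y_k\})\ \subset\ \mathcal{C}_x,$$ where $\mathscr{C}(\cdot)$ denotes the convex hull and $\mathcal{C}_x$ is the compact convex set determined by $x,\mu,\nu$ as defined in the context.
   Context: $\mu\preceq_{\rm cxp}\nu$ means $\int_{\mathbb{R}^d}\phi\,d\mu\leq\int_{\mathbb{R}^d}\phi\,d\nu$ for all non-negative convex functions $\phi:\mathbb{R}^d\to\mathbb{R}_+$. $S^{d-1}$ is the unit sphere of $\mathbb{R}^d$ and $\langle\cdot,\cdot\rangle$ the Euclidean scalar product. For $u\in S^{d-1}$ and $a\in\mathbb{R}$ let $$\phi_{\mu,u}(a)=\int_{\mathbb{R}^d}(\langle y,u\rangle-a)^+\,\mu(dy),\qquad \phi_{\nu,u}(a)=\int_{\mathbb{R}^d}(\langle y,u\rangle-a)^+\,\nu(dy).$$ For $x\in\mathbb{R}^d$ and $u\in S^{d-1}$ let $$a_{x,u}=\inf\{b\in\mathbb{R}:\ b\geq\langle u,x\rangle,\ \phi_{\mu,u}(b)=\phi_{\nu,u}(b)\},\qquad \mathcal{D}_{x,u}=\{y\in\mathbb{R}^d:\ \langle u,y\rangle\leq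 a_{x,u}\},$$ and $\mathcal{C}_x=\bigcap_{u\in S^{d-1}}\mathcal{D}_{x,u}$. *)

theory Defs
  imports "HOL-Analysis.Analysis"
begin

definition Supp :: "'a::topological_space measure \<Rightarrow> 'a set" where
  "Supp M = {x. \<forall>U. open U \<and> x \<in> U \<longrightarrow> emeasure M U > 0}"

(* Both sides may be infinite for general measures, hence the integral in [0, \<infinity>].
   Convex functions on the whole of R^d are continuous, so measurability is automatic. *)
definition cxp_le :: "(real^'d) measure \<Rightarrow> (real^'d) measure \<Rightarrow> bool" where
  "cxp_le \<mu> \<nu> \<longleftrightarrow>
    (\<forall>\<phi>. convex_on UNIV \<phi> \<and> (\<forall>y. 0 \<le> \<phi> y) \<longrightarrow>
      (\<integral>\<^sup>+ y. ennreal (\<phi> y) \<partial>\<mu>) \<le> (\<integral>\<^sup>+ y. ennreal (\<phi> y) \<partial>\<nu>))"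

definition call :: "(real^'d) measure \<Rightarrow> real^'d \<Rightarrow> real \<Rightarrow> real" where
  "call \<mu> u a = (LINT y|\<mu>. max 0 (y \<bullet> u - a))"

(* The set below is bounded from below by u \<bullet> x. For compactly supported measures it is
   nonempty, since both integrals vanish for large b; so Inf is a genuine infimum there. *)
definition a_bound :: "(real^'d) measure \<Rightarrow> (real^'d) measure \<Rightarrow> real^'d \<Rightarrow> real^'d \<Rightarrow> real" where
  "a_bound \<mu> \<nu> x u = Inf {b. b \<ge> u \<bullet> x \<and> call \<mu> u b = call \<nu> u b}"

definition D_half :: "(real^'d) measure \<Rightarrow> (real^'d) measure \<Rightarrow> real^'d \<Rightarrow> real^'d \<Rightarrow> (real^'d) set" where
  "D_half \<mu> \<nu> x u = {y. u \<bullet> y \<le> a_bound \<mu> \<nu> x u}"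

definition C_set :: "(real^'d) measure \<Rightarrow> (real^'d) measure \<Rightarrow> real^'d \<Rightarrow> (real^'d) set" where
  "C_set \<mu> \<nu> x = (\<Inter>u\<in>sphere 0 1. D_half \<mu> \<nu> x u)"

end

theory Submission
  imports Defs
begin

text \<open>
  By Farkas' lemma, the order \<open>\<mu> \<preceq>\<^sub>c\<^sub>x\<^sub>p \<nu>\<close> of finitely supported measures yields a transport \<open>q\<close> of \<open>\<mu>\<close> into
  \<open>\<nu>\<close> whose rows \<open>q x\<close> have barycentre \<open>x\<close>: an infeasibility certificate is a family of affine
  functions whose maximum with \<open>0\<close> violates the order. If \<open>\<mu>\<close> and \<open>\<nu>\<close> have the same call value in
  direction \<open>u\<close> at level \<open>a\<^sub>x\<^sub>,\<^sub>u\<close>, no mass of the row \<open>q x\<close> can cross that level, so the row is carried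
  by \<open>\<C>\<^sub>x\<close>. Since \<open>q x x \<le> \<nu>{x} < \<mu>{x}\<close>, the row charges points other than \<open>x\<close>, still with
  barycentre \<open>x\<close>, and Caratheodory's theorem selects at most \<open>d + 1\<close> of them.
\<close>

section \<open>Farkas' lemma for families of vectors\<close>

text \<open>Induction on \<open>I\<close>: either the generators other than \<open>k\<close> already
  force the inequality for \<open>b\<close>, or some direction separates \<open>b\<close> from them,
  and projecting along that direction eliminates \<open>k\<close>.\<close>

lemma farkas:
  fixes a :: "'i \<Rightarrow> 'j \<Rightarrow> 'e::real_inner" and b :: "'j \<Rightarrow> 'e"
  assumes "finite I" and "finite J"
    and "\<And>w. (\<And>i. i \<in> I \<Longrightarrow> (\<Sum>j\<in>J. a i j \<bullet> w j) \<le> 0) \<Longrightarrow> (\<Sum>j\<in>J. b j \<bullet> w j) \<le> 0"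
  obtains l :: "'i \<Rightarrow> real" where "\<And>i. i \<in> I \<Longrightarrow> 0 \<le> l i"
    and "\<And>j. j \<in> J \<Longrightarrow> b j = (\<Sum>i\<in>I. l i *\<^sub>R a i j)"
proof -
  have "\<exists>l :: 'i \<Rightarrow> real. (\<forall>i\<in>I. 0 \<le> l i) \<and> (\<forall>j\<in>J. b j = (\<Sum>i\<in>I. l i *\<^sub>R a i j))"
    using assms(1,3)
  proof (induction I arbitrary: a b rule: finite_induct)
    case empty
    \<comment> \<open>With no generators, \<open>b\<close> itself is an admissible test
      direction.\<close>
    have "(\<Sum>j\<in>J. b j \<bullet> b j) \<le> 0"
      by (rule empty) simp
    then have "(\<Sum>j\<in>J. b j \<bullet> b j) = 0"
      by (simp add: order_antisym sum_nonneg)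
    then show ?case
      using \<open>finite J\<close> by (simp add: sum_nonneg_eq_0_iff)
  next
    case (insert k I)
    define p where "p c w = (\<Sum>j\<in>J. c j \<bullet> w j)" for c w :: "'j \<Rightarrow> 'e"
    have p_scale_left: "p (\<lambda>j. c j - r *\<^sub>R d j) w = p c w - r * p d w"
      and p_scale_right: "p c (\<lambda>j. w j - r *\<^sub>R v j) = p c w - r * p c v"
      and p_scale: "p c (\<lambda>j. r *\<^sub>R v j) = r * p c v" for c d w v r
      by (simp_all add: p_def inner_diff sum_subtractf sum_distrib_left)
    show ?case
    proof (cases "\<forall>w. (\<forall>i\<in>I. p (a i) w \<le> 0) \<longrightarrow> p b w \<le> 0")
      case True
      then obtain l :: "'i \<Rightarrow> real"
        where "\<forall>i\<in>I. 0 \<le> l i" "\<forall>j\<in>J. b j = (\<Sum>i\<in>I. l i *\<^sub>R a i j)"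
        using insert.IH[of a b] by (auto simp: p_def)
      moreover have "(\<Sum>i\<in>I. (l(k := 0)) i *\<^sub>R a i j) = (\<Sum>i\<in>I. l i *\<^sub>R a i j)" for j
        using insert.hyps by (intro sum.cong) auto
      ultimately show ?thesis
        using insert.hyps by (intro exI[of _ "l(k := 0)"]) auto
    next
      case False
      then obtain v where v: "\<forall>i\<in>I. p (a i) v \<le> 0" "p b v > 0"
        by (auto simp: not_le)
      have hyp: "p b w \<le> 0" if "p (a k) w \<le> 0" "\<forall>i\<in>I. p (a i) w \<le> 0" for w
        using insert.prems[of w] that by (auto simp: p_def)
      \<comment> \<open>Otherwise \<open>v\<close> would meet every constraint of
        \<open>hyp\<close>, against \<open>p b v > 0\<close>.\<close>
      have kv: "p (a k) v > 0"
        using hyp[of v] v by fastforce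
      define z where "z = (\<lambda>j. (1 / p (a k) v) *\<^sub>R v j)"
      have z: "\<forall>i\<in>I. p (a i) z \<le> 0" "p b z > 0" "p (a k) z = 1"
        using v kv by (auto simp: z_def p_scale divide_nonpos_pos)
      \<comment> \<open>Project along z onto the kernel of the row k.\<close>
      define a' where "a' = (\<lambda>i j. a i j - p (a i) z *\<^sub>R a k j)"
      define b' where "b' = (\<lambda>j. b j - p b z *\<^sub>R a k j)"
      have "p b' w \<le> 0" if "\<forall>i\<in>I. p (a' i) w \<le> 0" for w
      proof -
        \<comment> \<open>The shifted direction is orthogonal to \<open>a k\<close>, and its pairing
          with \<open>a i\<close> is that of \<open>a' i\<close> with \<open>w\<close>.\<close>
        have "p b (\<lambda>j. w j - p (a k) w *\<^sub>R z j) \<le> 0"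
          using that z
          by (intro hyp) (auto simp: p_scale_right p_scale_left a'_def mult.commute)
        then show ?thesis
          by (simp add: p_scale_right p_scale_left b'_def mult.commute)
      qed
      then obtain l :: "'i \<Rightarrow> real"
        where l: "\<forall>i\<in>I. 0 \<le> l i" "\<forall>j\<in>J. b' j = (\<Sum>i\<in>I. l i *\<^sub>R a' i j)"
        using insert.IH[of a' b'] by (auto simp: p_def)
      \<comment> \<open>The total coefficient of \<open>a k\<close> once \<open>a'\<close> and
        \<open>b'\<close> are expanded; the signs of \<open>z\<close> make it non-negative.\<close>
      define c where "c = p b z - (\<Sum>i\<in>I. l i * p (a i) z)"
      have "(\<Sum>i\<in>I. l i * p (a i) z) \<le> 0"
        using l z by (intro sum_nonpos) (auto simp: mult_nonneg_nonpos)
      then have "c \<ge> 0"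
        using z by (simp add: c_def)
      moreover have "b j = c *\<^sub>R a k j + (\<Sum>i\<in>I. l i *\<^sub>R a i j)" if "j \<in> J" for j
      proof -
        have "b j = p b z *\<^sub>R a k j + (\<Sum>i\<in>I. l i *\<^sub>R a' i j)"
          using l that by (simp add: b'_def algebra_simps)
        then show ?thesis
          by (simp add: a'_def c_def algebra_simps sum_subtractf scaleR_sum_left)
      qed
      moreover have "(\<Sum>i\<in>I. (l(k := c)) i *\<^sub>R a i j) = (\<Sum>i\<in>I. l i *\<^sub>R a i j)" for j
        using insert.hyps by (intro sum.cong) auto
      ultimately show ?thesis
        using insert.hyps l by (intro exI[of _ "l(k := c)"]) auto
    qed
  qed
  then show ?thesis
    using that by blast
qed

section \<open>Strassen's theorem on finite sets\<close>

lemma convex_on_Max_affine: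
  fixes A :: "(real \<times> 'a::real_inner) set"
  assumes "finite A" and "A \<noteq> {}"
  shows "convex_on UNIV (\<lambda>y. Max ((\<lambda>(c, h). c + h \<bullet> y) ` A))"
proof (rule convex_onI)
  fix t :: real and y z :: 'a
  assume t: "0 < t" "t < 1"
  let ?M = "\<lambda>y. Max ((\<lambda>(c, h). c + h \<bullet> y) ` A)"
  have "c + h \<bullet> ((1 - t) *\<^sub>R y + t *\<^sub>R z) \<le> (1 - t) * ?M y + t * ?M z" if "(c, h) \<in> A" for c h
  proof -
    have "c + h \<bullet> w \<le> ?M w" for w
      using that assms by (intro Max_ge) force+
    then have "(1 - t) * (c + h \<bullet> y) + t * (c + h \<bullet> z) \<le> (1 - t) * ?M y + t * ?M z"
      using t by (intro add_mono mult_left_mono) auto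
    then show ?thesis
      by (simp add: inner_add_right algebra_simps)
  qed
  then show "?M ((1 - t) *\<^sub>R y + t *\<^sub>R z) \<le> (1 - t) * ?M y + t * ?M z"
    using assms by (intro Max.boundedI) auto
qed simp

text \<open>Strassen's theorem for finitely supported measures. The second marginal is only dominated
  by \<open>n\<close>, as the test functions are restricted to non-negative ones.\<close>

lemma discrete_strassen:
  fixes X Y :: "'a::real_inner set" and m n :: "'a \<Rightarrow> real"
  assumes fin: "finite X" "finite Y"
    and nonneg: "\<And>x. x \<in> X \<Longrightarrow> 0 \<le> m x" "\<And>y. y \<in> Y \<Longrightarrow> 0 \<le> n y"
    and le: "\<And>\<phi>. convex_on UNIV \<phi> \<Longrightarrow> (\<And>y. 0 \<le> \<phi> y) \<Longrightarrow>
      (\<Sum>x\<in>X. m x * \<phi> x) \<le> (\<Sum>y\<in>Y. n y * \<phi> y)"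
  obtains q :: "'a \<Rightarrow> 'a \<Rightarrow> real" where "\<And>x y. x \<in> X \<Longrightarrow> y \<in> Y \<Longrightarrow> 0 \<le> q x y"
    and "\<And>x. x \<in> X \<Longrightarrow> (\<Sum>y\<in>Y. q x y) = m x"
    and "\<And>x. x \<in> X \<Longrightarrow> (\<Sum>y\<in>Y. q x y *\<^sub>R y) = m x *\<^sub>R x"
    and "\<And>y. y \<in> Y \<Longrightarrow> (\<Sum>x\<in>X. q x y) \<le> n y"
proof -
  \<comment> \<open>The unknowns are \<open>q x y\<close>, indexed by \<open>Inl (x, y)\<close>, and the slack variables of the last
    inequality, indexed by \<open>Inr y\<close>. The constraint \<open>Inl x\<close> collects mass and barycentre.\<close>
  define a :: "'a \<times> 'a + 'a \<Rightarrow> 'a + 'a \<Rightarrow> real \<times> 'a" where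
    "a = case_sum
      (\<lambda>(x, y). case_sum (\<lambda>x'. if x' = x then (1, y - x) else 0) (\<lambda>y'. if y' = y then (1, 0) else 0))
      (\<lambda>y. case_sum (\<lambda>_. 0) (\<lambda>y'. if y' = y then (1, 0) else 0))"
  define b :: "'a + 'a \<Rightarrow> real \<times> 'a" where
    "b = case_sum (\<lambda>x. (m x, 0)) (\<lambda>y. (n y, 0))"
  have "(\<Sum>j\<in>X <+> Y. b j \<bullet> w j) \<le> 0"
    if w: "\<And>i. i \<in> (X \<times> Y) <+> Y \<Longrightarrow> (\<Sum>j\<in>X <+> Y. a i j \<bullet> w j) \<le> 0" for w
  proof -
    \<comment> \<open>The certificate \<open>w\<close> attaches to each \<open>x\<close> the affine
      function with value \<open>f x\<close> and slope \<open>h x\<close> at \<open>x\<close>, and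
      to each \<open>y\<close> the upper bound \<open>- g y\<close>.\<close>
    define f h g where "f x = fst (w (Inl x))" and "h x = snd (w (Inl x))"
      and "g y = fst (w (Inr y))" for x y
    have if_inner: "(if P then v else 0) \<bullet> u = (if P then v \<bullet> u else 0)"
      for P and v u :: "real \<times> 'a"
      by simp
    have pair_inner: "(r, k) \<bullet> v = r * fst v + k \<bullet> snd v" for r k and v :: "real \<times> 'a"
      by (simp add: inner_prod_def)
    have g: "g y \<le> 0" if "y \<in> Y" for y
      using w[of "Inr y"] that fin
      by (auto simp: sum.Plus a_def g_def if_inner pair_inner)
    have fg: "f x + h x \<bullet> (y - x) + g y \<le> 0" if "x \<in> X" "y \<in> Y" for x y
    proof -
      have "f x + (y - x) \<bullet> h x + g y \<le> 0"
        using w[of "Inl (x, y)"] that fin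
        by (auto simp: sum.Plus a_def f_def h_def g_def if_inner pair_inner)
      then show ?thesis
        by (simp add: inner_commute)
    qed
    \<comment> \<open>Affine functions are stored as intercept and slope. The pair
      \<open>(0, 0)\<close> makes their maximum non-negative, hence an admissible test
      function.\<close>
    define A where "A = insert (0, 0) ((\<lambda>x. (f x - h x \<bullet> x, h x)) ` X)"
    define \<phi> where "\<phi> y = Max ((\<lambda>(c, h). c + h \<bullet> y) ` A)" for y
    have A: "finite A" "A \<noteq> {}"
      using fin by (auto simp: A_def)
    have \<phi>_ge: "c + k \<bullet> y \<le> \<phi> y" if "(c, k) \<in> A" for c k y
      unfolding \<phi>_def using A that by (intro Max_ge) force+
    have "convex_on UNIV \<phi>"
      unfolding \<phi>_def by (rule convex_on_Max_affine[OF A])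
    moreover have "0 \<le> \<phi> y" for y
      using \<phi>_ge[of 0 0 y] by (simp add: A_def)
    ultimately have le': "(\<Sum>x\<in>X. m x * \<phi> x) \<le> (\<Sum>y\<in>Y. n y * \<phi> y)"
      by (rule le)
    have f\<phi>: "f x \<le> \<phi> x" if "x \<in> X" for x
      using \<phi>_ge[of "f x - h x \<bullet> x" "h x" x] that by (auto simp: A_def)
    \<comment> \<open>The pieces from \<open>X\<close> are bounded by \<open>fg\<close>, the zero
      piece by the slack constraints \<open>g\<close>.\<close>
    have \<phi>g: "\<phi> y \<le> - g y" if "y \<in> Y" for y
      unfolding \<phi>_def using A g fg that
      by (intro Max.boundedI) (fastforce simp: A_def inner_diff_right)+
    have "(\<Sum>x\<in>X. m x * f x) \<le> (\<Sum>x\<in>X. m x * \<phi> x)"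
      using f\<phi> nonneg by (intro sum_mono mult_left_mono) auto
    also note le'
    also have "(\<Sum>y\<in>Y. n y * \<phi> y) \<le> (\<Sum>y\<in>Y. n y * - g y)"
      using \<phi>g nonneg by (intro sum_mono mult_left_mono) auto
    finally show ?thesis
      using fin by (simp add: sum.Plus b_def pair_inner f_def g_def sum_negf)
  qed
  then obtain l where l: "\<And>i. i \<in> (X \<times> Y) <+> Y \<Longrightarrow> 0 \<le> l i"
    "\<And>j. j \<in> X <+> Y \<Longrightarrow> b j = (\<Sum>i\<in>(X \<times> Y) <+> Y. l i *\<^sub>R a i j)"
    using fin by (elim farkas[rotated -1]) auto
  define q where "q x y = l (Inl (x, y))" for x y
  have q: "0 \<le> q x y" if "x \<in> X" "y \<in> Y" for x y
    using l that by (auto simp: q_def)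
  have cart: "sum F (X \<times> Y) = (\<Sum>x\<in>X. \<Sum>y\<in>Y. F (x, y))" for F :: "'a \<times> 'a \<Rightarrow> real \<times> 'a"
    by (simp add: sum.cartesian_product)
  \<comment> \<open>Component \<open>Inl x\<close> of the Farkas identity: the first coordinate
    gives the mass of the row, the second its barycentre relative to \<open>x\<close>.\<close>
  have rows: "(\<Sum>y\<in>Y. q x y *\<^sub>R (1, y - x)) = (m x, 0)" if "x \<in> X" for x
  proof -
    have "(\<Sum>x'\<in>X. \<Sum>y\<in>Y. l (Inl (x', y)) *\<^sub>R (if x = x' then (1, y - x') else 0)) =
      (\<Sum>x'\<in>X. if x = x' then \<Sum>y\<in>Y. q x y *\<^sub>R (1 :: real, y - x) else 0)"
      by (intro sum.cong) (auto simp: q_def)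
    then show ?thesis
      using l(2)[of "Inl x"] that fin
      by (simp add: sum.Plus a_def b_def InlI cart sum.delta')
  qed
  have mass: "(\<Sum>y\<in>Y. q x y) = m x" if "x \<in> X" for x
    using arg_cong[OF rows[OF that], of fst] by (simp add: fst_sum)
  have "(\<Sum>y\<in>Y. q x y *\<^sub>R y) = m x *\<^sub>R x" if "x \<in> X" for x
    using arg_cong[OF rows[OF that], of snd] mass[OF that]
    by (simp add: snd_sum algebra_simps sum_subtractf flip: scaleR_sum_left)
  moreover have "(\<Sum>x\<in>X. q x y) \<le> n y" if "y \<in> Y" for y
  proof -
    have "(\<Sum>x\<in>X. \<Sum>y'\<in>Y. l (Inl (x, y')) *\<^sub>R (if y = y' then (1, 0) else 0)) =
      (\<Sum>x\<in>X. (q x y, 0 :: 'a))"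
      using that fin by (intro sum.cong) (auto simp: q_def if_distrib sum.delta' cong: if_cong)
    moreover have "(\<Sum>y'\<in>Y. l (Inr y') *\<^sub>R (if y = y' then (1, 0) else 0)) = (l (Inr y), 0 :: 'a)"
      using that fin by (auto simp: if_distrib sum.delta' cong: if_cong)
    ultimately have "n y = (\<Sum>x\<in>X. q x y) + l (Inr y)"
      using l(2)[of "Inr y"] that fin
      by (simp add: sum.Plus a_def b_def InrI cart prod_eq_iff fst_sum)
    then show ?thesis
      using l(1)[of "Inr y"] that by auto
  qed
  ultimately show ?thesis
    using that q mass by blast
qed

section \<open>Measures with finite support and their call functions\<close>

text \<open>The complement of the support is a union of open null sets, which the Lindelof property
  reduces to a countable union.\<close>

lemma AE_Supp:
  fixes M :: "'a::second_countable_topology measure"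
  assumes "sets M = sets borel"
  shows "AE y in M. y \<in> Supp M"
proof -
  define F where "F = {U. open U \<and> emeasure M U = 0}"
  obtain F' where F': "F' \<subseteq> F" "countable F'" "\<Union>F' = \<Union>F"
    by (rule Lindelof[of F]) (auto simp: F_def)
  have "\<Union>F' \<in> null_sets M"
    using F' assms null_sets_UN'[of F' "\<lambda>U. U" M] by (auto simp: F_def null_sets_def subset_iff)
  moreover have "\<Union>F = - Supp M"
    by (auto simp: F_def Supp_def zero_less_iff_neq_zero)
  ultimately show ?thesis
    using F' by (intro AE_I'[of "\<Union>F'"]) auto
qed

text \<open>Turns the convex order and the call functions into finite sums over atoms, the form used
  by the discrete lemmas.\<close>

lemma nn_integral_finite_Supp:
  fixes M :: "'a::{second_countable_topology, t1_space} measure"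
  assumes M: "sets M = sets borel" "finite_measure M" "finite (Supp M)" and f: "\<And>y. 0 \<le> f y"
  shows "(\<integral>\<^sup>+ y. ennreal (f y) \<partial>M) = ennreal (\<Sum>y\<in>Supp M. measure M {y} * f y)"
proof -
  have "(\<integral>\<^sup>+ y. ennreal (f y) \<partial>M) = (\<integral>\<^sup>+ y. ennreal (f y) * indicator (Supp M) y \<partial>M)"
    using AE_Supp[OF M(1)] by (intro nn_integral_cong_AE) auto
  also have "\<dots> = (\<Sum>y\<in>Supp M. ennreal (f y) * emeasure M {y})"
    using M by (intro nn_integral_indicator_finite) auto
  also have "\<dots> = ennreal (\<Sum>y\<in>Supp M. measure M {y} * f y)"
    using f M
    by (simp add: finite_measure.emeasure_eq_measure mult.commute flip: ennreal_mult sum_ennreal)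
  finally show ?thesis .
qed

lemma call_finite_Supp:
  assumes "sets M = sets borel" "finite_measure M" "finite (Supp M)"
  shows "call M u b = (\<Sum>y\<in>Supp M. measure M {y} * max 0 (y \<bullet> u - b))"
proof -
  have "(\<lambda>y. max 0 (y \<bullet> u - b)) \<in> borel_measurable M"
    using assms by (simp cong: measurable_cong_sets)
  then show ?thesis
    using assms
    by (simp add: call_def integral_eq_nn_integral nn_integral_finite_Supp sum_nonneg)
qed

text \<open>The set defining the infimum is closed, because both call functions are continuous in
  the level, and it is non-empty and bounded below.\<close>

lemma a_bound_attained:
  assumes \<mu>: "sets \<mu> = sets borel" "finite_measure \<mu>" "finite (Supp \<mu>)"
    and \<nu>: "sets \<nu> = sets borel" "finite_measure \<nu>" "finite (Supp \<nu>)"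
  shows "u \<bullet> x \<le> a_bound \<mu> \<nu> x u"
    and "call \<mu> u (a_bound \<mu> \<nu> x u) = call \<nu> u (a_bound \<mu> \<nu> x u)"
proof -
  let ?S = "{b. b \<ge> u \<bullet> x \<and> call \<mu> u b = call \<nu> u b}"
  have "closed ?S"
    unfolding call_finite_Supp[OF \<mu>] call_finite_Supp[OF \<nu>]
    by (intro closed_Collect_conj closed_Collect_le closed_Collect_eq continuous_intros)
  moreover have "?S \<noteq> {}"
  proof -
    \<comment> \<open>Beyond both supports the two call functions vanish; inserting
      \<open>u \<bullet> x\<close> keeps the level admissible.\<close>
    define b where "b = Max (insert (u \<bullet> x) ((\<lambda>y. y \<bullet> u) ` (Supp \<mu> \<union> Supp \<nu>)))"
    have "u \<bullet> x \<le> b" and "\<And>y. y \<in> Supp \<mu> \<union> Supp \<nu> \<Longrightarrow> y \<bullet> u \<le> b"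
      unfolding b_def using \<mu> \<nu> by (auto intro!: Max_ge)
    then have "b \<in> ?S"
      unfolding call_finite_Supp[OF \<mu>] call_finite_Supp[OF \<nu>] by simp
    then show ?thesis
      by blast
  qed
  moreover have "bdd_below ?S"
    by (auto intro!: bdd_belowI)
  ultimately have "Inf ?S \<in> ?S"
    by (rule closed_contains_Inf[rotated 2])
  then show "u \<bullet> x \<le> a_bound \<mu> \<nu> x u"
    and "call \<mu> u (a_bound \<mu> \<nu> x u) = call \<nu> u (a_bound \<mu> \<nu> x u)"
    by (simp_all add: a_bound_def)
qed

section \<open>Rows of the transport: half-spaces and barycentres\<close>

text \<open>Equality at level \<open>b\<close> forces equality in Jensen's inequality for each row of the kernel, so a
  row whose barycentre lies below \<open>b\<close> does not charge the open half-space above \<open>b\<close>.\<close>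

lemma kernel_below_level:
  fixes X Y :: "'a::real_inner set" and q :: "'a \<Rightarrow> 'a \<Rightarrow> real"
  assumes fin: "finite X" "finite Y"
    and q: "\<And>x y. x \<in> X \<Longrightarrow> y \<in> Y \<Longrightarrow> 0 \<le> q x y"
    and mass: "\<And>x. x \<in> X \<Longrightarrow> (\<Sum>y\<in>Y. q x y) = m x"
    and mean: "\<And>x. x \<in> X \<Longrightarrow> (\<Sum>y\<in>Y. q x y *\<^sub>R y) = m x *\<^sub>R x"
    and marg: "\<And>y. y \<in> Y \<Longrightarrow> (\<Sum>x\<in>X. q x y) \<le> n y"
    and eq: "(\<Sum>x\<in>X. m x * max 0 (x \<bullet> u - b)) = (\<Sum>y\<in>Y. n y * max 0 (y \<bullet> u - b))"
    and x: "x \<in> X" "x \<bullet> u \<le> b" and y: "y \<in> Y" "q x y > 0"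
  shows "y \<bullet> u \<le> b"
proof -
  let ?c = "\<lambda>y. max 0 (y \<bullet> u - b)"
  have jensen: "m x * ?c x \<le> (\<Sum>y\<in>Y. q x y * ?c y)" if "x \<in> X" for x
  proof -
    have "m x * (x \<bullet> u - b) = (\<Sum>y\<in>Y. q x y * (y \<bullet> u - b))"
      using arg_cong[OF mean[OF that], of "\<lambda>v. v \<bullet> u"] mass[OF that]
      by (simp add: inner_sum_left algebra_simps sum_subtractf flip: sum_distrib_left)
    also have "\<dots> \<le> (\<Sum>y\<in>Y. q x y * ?c y)"
      using q that by (intro sum_mono mult_left_mono) auto
    finally have "m x * (x \<bullet> u - b) \<le> (\<Sum>y\<in>Y. q x y * ?c y)" .
    moreover have "0 \<le> (\<Sum>y\<in>Y. q x y * ?c y)"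
      using q that by (intro sum_nonneg mult_nonneg_nonneg) auto
    ultimately show ?thesis
      by (simp add: max_def)
  qed
  have "(\<Sum>x\<in>X. \<Sum>y\<in>Y. q x y * ?c y) = (\<Sum>y\<in>Y. (\<Sum>x\<in>X. q x y) * ?c y)"
    by (subst sum.swap) (simp add: sum_distrib_right)
  also have "\<dots> \<le> (\<Sum>y\<in>Y. n y * ?c y)"
    using marg by (intro sum_mono mult_right_mono) auto
  finally have "(\<Sum>x\<in>X. \<Sum>y\<in>Y. q x y * ?c y) \<le> (\<Sum>x\<in>X. m x * ?c x)"
    using eq by simp
  \<comment> \<open>The Jensen gaps are non-negative and their total is at most zero, so each one
    vanishes.\<close>
  then have "(\<Sum>x\<in>X. (\<Sum>y\<in>Y. q x y * ?c y) - m x * ?c x) = 0"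
    using sum_mono[of X "\<lambda>x. m x * ?c x", OF jensen] by (simp add: sum_subtractf)
  then have "(\<Sum>y\<in>Y. q x y * ?c y) = m x * ?c x"
    using fin x jensen by (subst (asm) sum_nonneg_eq_0_iff) auto
  then have "(\<Sum>y\<in>Y. q x y * ?c y) = 0"
    using x by simp
  then have "q x y * ?c y = 0"
    using fin x y q by (subst (asm) sum_nonneg_eq_0_iff) auto
  then show ?thesis
    using y by (simp add: max_def split: if_splits)
qed

text \<open>Removing the mass at the barycentre \<open>x\<close> does not move the barycentre;
  \<open>gt\<close> guarantees that mass remains to normalise.\<close>

lemma mean_in_convex_hull_positive:
  fixes Y :: "'a::real_vector set" and w :: "'a \<Rightarrow> real"
  assumes fin: "finite Y" and w: "\<And>y. y \<in> Y \<Longrightarrow> 0 \<le> w y"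
    and mean: "(\<Sum>y\<in>Y. w y *\<^sub>R y) = (\<Sum>y\<in>Y. w y) *\<^sub>R x"
    and gt: "(\<Sum>y\<in>Y. w y) > (if x \<in> Y then w x else 0)"
  shows "x \<in> convex hull {y \<in> Y. 0 < w y \<and> y \<noteq> x}"
proof -
  let ?P = "{y \<in> Y. 0 < w y \<and> y \<noteq> x}"
  define s where "s = sum w ?P"
  have fP: "finite ?P"
    using fin by simp
  have "(\<Sum>y\<in>Y. w y) = (\<Sum>y\<in>Y. (if y \<in> ?P then w y else 0) + (if x = y then w y else 0))"
    using w by (intro sum.cong) (auto simp: order_less_le)
  also have "\<dots> = s + (if x \<in> Y then w x else 0)"
    unfolding sum.distrib s_def using fin by (simp add: sum.delta' sum.inter_filter)
  finally have "s > 0"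
    using gt by simp
  \<comment> \<open>The dropped points have weight zero or equal \<open>x\<close>, so their centred
    terms vanish.\<close>
  have "(\<Sum>y\<in>?P. w y *\<^sub>R (y - x)) = (\<Sum>y\<in>Y. w y *\<^sub>R (y - x))"
    using fin w by (intro sum.mono_neutral_left) (force simp: order_less_le)+
  also have "\<dots> = 0"
    using mean by (simp add: algebra_simps sum_subtractf flip: scaleR_sum_left)
  finally have "(\<Sum>y\<in>?P. w y *\<^sub>R y) = s *\<^sub>R x"
    by (simp add: s_def scaleR_diff_right sum_subtractf flip: scaleR_sum_left)
  moreover have "(\<Sum>y\<in>?P. (w y / s) *\<^sub>R y) = (1 / s) *\<^sub>R (\<Sum>y\<in>?P. w y *\<^sub>R y)"
    by (simp add: scaleR_sum_right)
  ultimately have "(\<Sum>y\<in>?P. (w y / s) *\<^sub>R y) = x"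
    using \<open>s > 0\<close> by simp
  moreover have "(\<Sum>y\<in>?P. w y / s) = 1"
    using \<open>s > 0\<close> by (simp add: s_def flip: sum_divide_distrib)
  ultimately show ?thesis
    unfolding convex_hull_finite[OF fP] using \<open>s > 0\<close>
    by (auto intro!: exI[of _ "\<lambda>y. w y / s"])
qed

section \<open>Selection of the points and their hull\<close>

theorem theorem5p5:
  fixes \<mu> \<nu> :: "(real^'d) measure"
  assumes "sets \<mu> = sets borel" and "sets \<nu> = sets borel"
    and "finite_measure \<mu>" and "finite_measure \<nu>"
    and "finite (Supp \<mu>)" and "finite (Supp \<nu>)"
    and "cxp_le \<mu> \<nu>"
  shows "\<forall>x. measure \<mu> {x} > measure \<nu> {x} \<longrightarrow>
    (\<exists>k\<in>{2..CARD('d) + 1}. \<exists>y :: nat \<Rightarrow> real^'d.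
      inj_on y {1..k} \<and>
      (\<forall>i\<in>{1..k}. y i \<in> Supp \<nu> \<and> y i \<noteq> x) \<and>
      {x} \<subseteq> convex hull (y ` {1..k}) \<and>
      convex hull (y ` {1..k}) \<subseteq> C_set \<mu> \<nu> x)"
proof (intro allI impI)
  fix x
  assume gt: "measure \<mu> {x} > measure \<nu> {x}"
  note \<mu> = assms(1,3,5) and \<nu> = assms(2,4,6)
  have "(\<Sum>y\<in>Supp \<mu>. measure \<mu> {y} * \<phi> y) \<le> (\<Sum>y\<in>Supp \<nu>. measure \<nu> {y} * \<phi> y)"
    if "convex_on UNIV \<phi>" "\<And>y. 0 \<le> \<phi> y" for \<phi>
  proof -
    have "(\<integral>\<^sup>+ y. ennreal (\<phi> y) \<partial>\<mu>) \<le> (\<integral>\<^sup>+ y. ennreal (\<phi> y) \<partial>\<nu>)"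
      using assms(7) that by (auto simp: cxp_le_def)
    then show ?thesis
      using that by (simp add: nn_integral_finite_Supp \<mu> \<nu> ennreal_le_iff sum_nonneg)
  qed
  then obtain q where q: "\<And>x y. x \<in> Supp \<mu> \<Longrightarrow> y \<in> Supp \<nu> \<Longrightarrow> 0 \<le> q x y"
    and mass: "\<And>x. x \<in> Supp \<mu> \<Longrightarrow> (\<Sum>y\<in>Supp \<nu>. q x y) = measure \<mu> {x}"
    and mean: "\<And>x. x \<in> Supp \<mu> \<Longrightarrow> (\<Sum>y\<in>Supp \<nu>. q x y *\<^sub>R y) = measure \<mu> {x} *\<^sub>R x"
    and marg: "\<And>y. y \<in> Supp \<nu> \<Longrightarrow> (\<Sum>x\<in>Supp \<mu>. q x y) \<le> measure \<nu> {y}"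
    using \<mu> \<nu>
    by (elim discrete_strassen[of "Supp \<mu>" "Supp \<nu>" "\<lambda>y. measure \<mu> {y}" "\<lambda>y. measure \<nu> {y}", rotated -1])
      auto
  have "measure \<mu> {x} > 0"
    using gt measure_nonneg order_le_less_trans by blast
  then have x: "x \<in> Supp \<mu>"
    using finite_measure.finite_measure_mono[OF \<mu>(2), of "{x}"] \<mu>
    by (force simp: Supp_def finite_measure.emeasure_eq_measure)
  \<comment> \<open>The diagonal entry is one term of a column sum bounded by
    \<open>marg\<close>.\<close>
  have "q x x \<le> measure \<nu> {x}" if "x \<in> Supp \<nu>"
    using marg[OF that] member_le_sum[of x "Supp \<mu>" "\<lambda>z. q z x"] q x that \<mu> by fastforce
  then have "(\<Sum>y\<in>Supp \<nu>. q x y) > (if x \<in> Supp \<nu> then q x x else 0)"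
    using gt \<open>measure \<mu> {x} > 0\<close> mass[OF x] by auto
  then have "x \<in> convex hull {y \<in> Supp \<nu>. 0 < q x y \<and> y \<noteq> x}"
    using q x mean[OF x] mass[OF x] \<nu> by (intro mean_in_convex_hull_positive) auto
  then obtain T where T: "finite T" "T \<subseteq> {y \<in> Supp \<nu>. 0 < q x y \<and> y \<noteq> x}"
      "card T \<le> CARD('d) + 1" "x \<in> convex hull T"
    unfolding caratheodory[of "{y \<in> Supp \<nu>. 0 < q x y \<and> y \<noteq> x}"] by auto
  \<comment> \<open>The hull of the empty set is empty, and that of a single point of
    \<open>T\<close> misses \<open>x\<close>.\<close>
  have "card T \<noteq> 0" "card T \<noteq> 1"
    using T by (auto simp: card_1_singleton_iff)
  then have "2 \<le> card T"
    by linarith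
  then have card: "card T \<in> {2..CARD('d) + 1}"
    using T by simp
  have "T \<subseteq> C_set \<mu> \<nu> x"
  proof
    fix y
    assume "y \<in> T"
    then have y: "y \<in> Supp \<nu>" "q x y > 0"
      using T by auto
    \<comment> \<open>\<open>a_bound\<close> is a level at or above \<open>x\<close> where the call
      functions agree, so the row of \<open>x\<close> cannot charge points beyond it.\<close>
    have "y \<bullet> u \<le> a_bound \<mu> \<nu> x u" for u
    proof (rule kernel_below_level[OF \<mu>(3) \<nu>(3) q mass mean marg _ x _ y])
      show "x \<bullet> u \<le> a_bound \<mu> \<nu> x u"
        using a_bound_attained(1)[OF \<mu> \<nu>] by (simp add: inner_commute)
    qed (use a_bound_attained(2)[OF \<mu> \<nu>] in \<open>simp_all add: call_finite_Supp \<mu> \<nu>\<close>)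
    then show "y \<in> C_set \<mu> \<nu> x"
      by (simp add: C_set_def D_half_def inner_commute)
  qed
  moreover have "convex (C_set \<mu> \<nu> x)"
    unfolding C_set_def D_half_def by (intro convex_INT convex_halfspace_le)
  ultimately have hull: "convex hull T \<subseteq> C_set \<mu> \<nu> x"
    by (rule hull_minimal)
  obtain y where "bij_betw y {1..card T} T"
    using ex_bij_betw_nat_finite_1[OF T(1)] by blast
  then have y: "inj_on y {1..card T}" "y ` {1..card T} = T"
    by (auto simp: bij_betw_def)
  then have "\<forall>i\<in>{1..card T}. y i \<in> Supp \<nu> \<and> y i \<noteq> x"
    using T by auto
  then show "\<exists>k\<in>{2..CARD('d) + 1}. \<exists>y :: nat \<Rightarrow> real^'d.
      inj_on y {1..k} \<and>
      (\<forall>i\<in>{1..k}. y i \<in> Supp \<nu> \<and> y i \<noteq> x) \<and>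
      {x} \<subseteq> convex hull (y ` {1..k}) \<and>
      convex hull (y ` {1..k}) \<subseteq> C_set \<mu> \<nu> x"
    using card y T hull by (intro bexI[OF _ card] exI[of _ y]) simp
qed

end
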